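(* Let $d\ge2$ be even, $n\ge2$, $\mathcal A\in\mathbb S^{n^d}$, $\tau>0$, and let $\{\mathcal X^k,\mathcal Y^k,\Lambda^k\}$ be generated by the nonconvex ADMM with parameter $\tau$. Assume that there exists a tuple $\{\mathcal X^*,\mathcal Y^*,\Lambda^*\}$ with $\mathcal X^*\in C$, $\mathcal Y^*\in\mathbb S^{n^d}$, $\Lambda^*\in\mathbb R^{n^d}$ satisfying $$\langle-\Lambda^*-\tau\mathcal Y^*,\mathcal X-\mathcal X^*\rangle\ge0\ \ \forall\mathcal X\in C,\qquad \mathrm{Sym}(\Lambda^* )=\mathcal A,\qquad\mathcal X^*=\mathcal Y^*,$$ where (without loss of generality) $\mathrm{Mat}(\Lambda^* )$ is a symmetric matrix. Assume that the leading (largest) eigenvalue of $\mathrm{Mat}(\Lambda^* )$ is simple. Let $N=n^{d/2}$ and let $\sigma_1\ge\cdots\ge\sigma_N$ be the eigenvalues of $-\mathrm{Mat}(\Lambda^* )$. If $$0<\tau<\sigma_{N-1}-\sigma_N,$$ then $\{\mathcal X^k,\mathcal Y^k\}$ converges to $\{\mathcal X^*,\mathcal Y^*\}$, and $\mathcal X^*=\mathcal Y^*$ is a global optimizer of problem (O).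
   Context: All tensors are real. $\mathbb R^{n^d}$ is the space of $d$-th order $n$-dimensional tensors with entrywise inner product $\langle\cdot,\cdot\rangle$ and Frobenius norm; $\mathbb S^{n^d}$ is the subspace of symmetric tensors (entries invariant under all permutations of the indices). $\mathrm{Sym}(\mathcal B)$ is the average of $\mathcal B$ over all $d!$ permutations of its indices. For even $d$, $\mathrm{Mat}(\mathcal B)\in\mathbb R^{n^{d/2}\times n^{d/2}}$ is the reshaping of $\mathcal B$ with rows indexed by the first $d/2$ indices and columns by the last $d/2$ indices (enumerated in the same way). $C=\{\mathcal X\in\mathbb R^{n^d}\mid \operatorname{rank}(\mathrm{Mat}(\mathcal X))=1,\ \mathrm{Mat}(\mathcal X)\text{ symmetric},\ \operatorname{tr}(\mathrm{Mat}(\mathcal X))=1\}$. Problem (O) ($d$ even): maximize $\langle\mathcal A,\mathcal X\rangle$ subject to $\operatorname{rank}(\mathrm{Mat}(\mathcal X))=1$, $\mathcal X\in\mathbb S^{n^d}$, $\operatorname{tr}(\mathrm{Mat}(\mathcal X))=1$; equivalently, minimize $\langle-\mathcal A,\mathcal Y\rangle$ subject to $\mathcal X=\mathcal Y$, $\mathcal X\in C$, $\mathcal Y\in\mathbb S^{n^d}$. Nonconvex ADMM with parameter $\tau>0$: start from any $\mathcal Y^0\in\mathbb S^{n^d}$ and $\Lambda^0\in\mathbb R^{n^d}$ with $\mathrm{Mat}(\Lambda^0)$ symmetric; for $k=0,1,2,\dots$, $$\mathcal X^{k+1}\in\arg\max_{\mathcal X\in C}\langle\Lambda^k+\tau\mathcal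 Y^k,\mathcal X\rangle,\quad \mathcal Y^{k+1}=\tau^{-1}\mathrm{Sym}(\mathcal A-\Lambda^k+\tau\mathcal X^{k+1}),\quad \Lambda^{k+1}=\Lambda^k-\tau(\mathcal X^{k+1}-\mathcal Y^{k+1}),$$ where any maximizer may be chosen (equivalently $\mathrm{Mat}(\mathcal X^{k+1})=\mathbf x\mathbf x^\top$ with $\mathbf x$ a unit leading eigenvector of $\mathrm{Mat}(\Lambda^k+\tau\mathcal Y^k)$). *)

theory Defs
  imports
    "HOL-Analysis.Analysis"
    "HOL-Combinatorics.Permutations"
    "HOL-Computational_Algebra.Polynomial"
begin

text \<open>
  A tensor of order \<open>d = CARD('d)\<close> and dimension \<open>n = CARD('n)\<close> is a real vector whose index set
  consists of all multi-indices \<open>'d \<Rightarrow> 'n\<close>. The library inner product, norm and topology on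
  \<open>real ^ _\<close> are then the entrywise inner product, the Frobenius norm and its topology.
\<close>

type_synonym ('n, 'd) tensor = "(real, 'd \<Rightarrow> 'n) vec"

definition symmetric_tensors :: "('n::finite, 'd::finite) tensor set" where
  "symmetric_tensors = {B. \<forall>p. p permutes UNIV \<longrightarrow> (\<forall>i. B $ (i \<circ> p) = B $ i)}"

definition Sym :: "('n::finite, 'd::finite) tensor \<Rightarrow> ('n, 'd) tensor" where
  "Sym B = (1 / fact CARD('d)) *\<^sub>R (\<Sum>p | p permutes (UNIV :: 'd set). \<chi> i. B $ (i \<circ> p))"

text \<open>
  A tensor of even order \<open>d = 2 * CARD('m)\<close> has the disjoint sum \<open>'m + 'm\<close> as its set of index
  positions: \<open>Inl\<close> marks the first \<open>d/2\<close> positions and \<open>Inr\<close> the last \<open>d/2\<close>. Rows and columns of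
  \<open>Mat B\<close> are both indexed by the multi-indices \<open>'m \<Rightarrow> 'n\<close>, so its size is \<open>n ^ (d/2)\<close>.
\<close>

definition Mat ::
    "('n::finite, 'm::finite + 'm) tensor \<Rightarrow> ((real, 'm \<Rightarrow> 'n) vec, 'm \<Rightarrow> 'n) vec" where
  "Mat B = (\<chi> r c. B $ case_sum r c)"

definition symmetric_matrix :: "'a ^ 'k ^ 'k \<Rightarrow> bool" where
  "symmetric_matrix M \<longleftrightarrow> transpose M = M"

definition eigenvalue :: "real ^ 'k ^ 'k \<Rightarrow> real \<Rightarrow> bool" where
  "eigenvalue M l \<longleftrightarrow> (\<exists>v. v \<noteq> 0 \<and> M *v v = l *\<^sub>R v)"

definition charpoly :: "real ^ 'k ^ 'k \<Rightarrow> real poly" where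
  "charpoly M = det (mat [:0, 1:] - map_matrix (\<lambda>a. [:a:]) M)"

definition leading_eigenvalue :: "real ^ 'k ^ 'k \<Rightarrow> real \<Rightarrow> bool" where
  "leading_eigenvalue M l \<longleftrightarrow> eigenvalue M l \<and> (\<forall>l'. eigenvalue M l' \<longrightarrow> l' \<le> l)"

definition simple_eigenvalue :: "real ^ 'k ^ 'k \<Rightarrow> real \<Rightarrow> bool" where
  "simple_eigenvalue M l \<longleftrightarrow> eigenvalue M l \<and> order l (charpoly M) = 1"

text \<open>
  \<open>s 1 \<ge> \<dots> \<ge> s N\<close> are all the eigenvalues of \<open>M\<close>, repeated according to multiplicity, where \<open>N\<close> is
  the size of \<open>M\<close>. Values of \<open>s\<close> outside \<open>{1..N}\<close> are irrelevant.
\<close>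

definition ordered_eigenvalues :: "real ^ 'k ^ 'k \<Rightarrow> (nat \<Rightarrow> real) \<Rightarrow> bool" where
  "ordered_eigenvalues M s \<longleftrightarrow>
     charpoly M = (\<Prod>i = 1..CARD('k). [:- s i, 1:]) \<and>
     (\<forall>i j. 1 \<le> i \<and> i \<le> j \<and> j \<le> CARD('k) \<longrightarrow> s j \<le> s i)"

definition C_set :: "('n::finite, 'm::finite + 'm) tensor set" where
  "C_set = {X. rank (Mat X) = 1 \<and> symmetric_matrix (Mat X) \<and> trace (Mat X) = 1}"

definition O_feasible :: "('n::finite, 'm::finite + 'm) tensor \<Rightarrow> bool" where
  "O_feasible X \<longleftrightarrow> rank (Mat X) = 1 \<and> X \<in> symmetric_tensors \<and> trace (Mat X) = 1"

definition O_global_optimizer ::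
    "('n::finite, 'm::finite + 'm) tensor \<Rightarrow> ('n, 'm + 'm) tensor \<Rightarrow> bool" where
  "O_global_optimizer A X \<longleftrightarrow> is_arg_max (\<lambda>Z. A \<bullet> Z) O_feasible X"

text \<open>The term \<open>X 0\<close> is not produced by the iteration and is left unconstrained.\<close>

definition nonconvex_ADMM ::
    "('n::finite, 'm::finite + 'm) tensor \<Rightarrow> real \<Rightarrow> (nat \<Rightarrow> ('n, 'm + 'm) tensor) \<Rightarrow>
     (nat \<Rightarrow> ('n, 'm + 'm) tensor) \<Rightarrow> (nat \<Rightarrow> ('n, 'm + 'm) tensor) \<Rightarrow> bool" where
  "nonconvex_ADMM A \<tau> X Y L \<longleftrightarrow>
     Y 0 \<in> symmetric_tensors \<and> symmetric_matrix (Mat (L 0)) \<and>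
     (\<forall>k. is_arg_max (\<lambda>Z. (L k + \<tau> *\<^sub>R Y k) \<bullet> Z) (\<lambda>Z. Z \<in> C_set) (X (Suc k)) \<and>
          Y (Suc k) = (1 / \<tau>) *\<^sub>R Sym (A - L k + \<tau> *\<^sub>R X (Suc k)) \<and>
          L (Suc k) = L k - \<tau> *\<^sub>R (X (Suc k) - Y (Suc k)))"

end

theory Submission
  imports Defs
begin

text \<open>
  The set \<open>C\<close> consists of the squares \<open>z \<otimes> z\<close> of unit vectors, on which a linear functional \<open>B\<close>
  becomes the quadratic form of \<open>Mat B\<close>. As \<open>\<tau>\<close> is below the gap \<open>\<delta> = \<sigma> (N - 1) - \<sigma> N\<close> of
  \<open>Mat \<Lambda>\<^sup>*\<close>, the optimality condition forces \<open>X\<^sup>*\<close> to be the square of its leading eigenvector, which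
  gives global optimality and the quadratic growth
  \<open>\<Lambda>\<^sup>* \<bullet> (X\<^sup>* - X) \<ge> \<delta>/2 |X - X\<^sup>*|\<^sup>2\<close> on \<open>C\<close>. After one step \<open>Sym \<Lambda>\<^sup>k = A\<close>, after two
  \<open>Y\<^sup>k = Sym X\<^sup>k\<close>, and then the Lyapunov function
  \<open>|\<Lambda>\<^sup>k - \<Lambda>\<^sup>*|\<^sup>2 / (2 \<tau>) + \<tau>/2 |Y\<^sup>k - Y\<^sup>*|\<^sup>2\<close> drops by at least
  \<open>(\<delta> - \<tau>)/2 |X\<^sup>k\<^sup>+\<^sup>1 - X\<^sup>*|\<^sup>2\<close> in step \<open>k\<close>.
\<close>

section \<open>Symmetric matrices and the roots of the characteristic polynomial\<close>

lemma symmetric_matrix_inner: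
  fixes M :: "real ^ 'k ^ 'k"
  assumes "symmetric_matrix M"
  shows "x \<bullet> (M *v y) = (M *v x) \<bullet> y"
  by (metis assms dot_lmul_matrix symmetric_matrix_def vector_transpose_matrix)

text \<open>Evaluation at \<open>r\<close> is a ring homomorphism, so it passes through the Leibniz
  expansion of the determinant.\<close>

lemma poly_charpoly:
  fixes M :: "real ^ 'k::finite ^ 'k"
  shows "poly (charpoly M) r = det (mat r - M)"
proof -
  have e: "poly (mat [:0, 1:] $ i $ j) r = (mat r :: real ^ 'k ^ 'k) $ i $ j" for i j :: 'k
    by (simp add: mat_def)
  have s: "poly (of_int (sign p)) r = of_int (sign p)" for p :: "'k \<Rightarrow> 'k"
    by (simp add: sign_def)
  show ?thesis
    unfolding charpoly_def det_def by (simp add: poly_sum poly_prod e s)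
qed

lemma charpoly_root_iff: "poly (charpoly M) r = 0 \<longleftrightarrow> eigenvalue M r"
proof -
  have "mat r *v v = r *\<^sub>R v" for v :: "real ^ 'k"
    by (simp add: mat_def vec_eq_iff matrix_vector_mult_def if_distrib if_distribR cong: if_cong)
  then have e: "(mat r - M) *v v = r *\<^sub>R v - M *v v" for v
    by (simp add: matrix_vector_mult_diff_rdistrib)
  have "poly (charpoly M) r = 0 \<longleftrightarrow> \<not> invertible (mat r - M)"
    by (simp add: poly_charpoly invertible_det_nz)
  also have "\<dots> \<longleftrightarrow> (\<exists>v. v \<noteq> 0 \<and> (mat r - M) *v v = 0)"
    unfolding invertible_left_inverse matrix_left_invertible_ker by blast
  also have "\<dots> \<longleftrightarrow> eigenvalue M r"
    unfolding eigenvalue_def e by (metis eq_iff_diff_eq_0)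
  finally show ?thesis .
qed

section \<open>Extremal eigenvectors, multiplicities and the spectral gap\<close>

text \<open>The quadratic form attains its maximum on the compact unit sphere of \<open>S\<close>,
  and a maximizer is an eigenvector. The invariant subspace is a parameter so that the lemma serves
  twice: on the whole space for the leading eigenvector, and on its orthogonal complement for the
  next one.\<close>

lemma Rayleigh_maximizer:
  fixes M :: "real ^ 'k ^ 'k"
  assumes M: "symmetric_matrix M" and S: "subspace S" and inv: "\<And>x. x \<in> S \<Longrightarrow> M *v x \<in> S"
    and "u \<in> S" "u \<noteq> 0"
  obtains v where "v \<in> S" "norm v = 1" "M *v v = (v \<bullet> (M *v v)) *\<^sub>R v"
    "\<And>z. z \<in> S \<Longrightarrow> z \<bullet> (M *v z) \<le> (v \<bullet> (M *v v)) * (z \<bullet> z)"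
proof -
  let ?T = "sphere 0 1 \<inter> S"
  have "compact ?T" using closed_subspace [OF S] by (intro compact_Int_closed) auto
  moreover have "(1 / norm u) *\<^sub>R u \<in> ?T" using assms by (simp add: subspace_scale)
  then have "?T \<noteq> {}" by blast
  moreover have "continuous_on ?T (\<lambda>x. x \<bullet> (M *v x))"
    by (intro continuous_intros linear_continuous_on matrix_vector_mul_bounded_linear)
  ultimately obtain v where v: "v \<in> ?T" and vmax: "\<And>x. x \<in> ?T \<Longrightarrow> x \<bullet> (M *v x) \<le> v \<bullet> (M *v v)"
    using continuous_attains_sup [of ?T "\<lambda>x. x \<bullet> (M *v x)"] by blast
  define l where "l = v \<bullet> (M *v v)"
  have vv: "v \<bullet> v = 1" using v by (simp add: dot_square_norm)
  have le: "z \<bullet> (M *v z) \<le> l * (z \<bullet> z)" if "z \<in> S" for z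
  proof (cases "z = 0")
    case False
    then have "(1 / norm z) *\<^sub>R z \<in> ?T" using that S by (simp add: subspace_scale)
    from vmax [OF this] have "z \<bullet> (M *v z) / (norm z)\<^sup>2 \<le> l"
      by (simp add: l_def matrix_vector_mult_scaleR power2_eq_square)
    then show ?thesis using False by (simp add: divide_le_eq dot_square_norm)
  qed auto
  \<comment> \<open>The form \<open>l |z|^2 - z \<bullet> M z\<close> is nonnegative on \<open>S\<close> and vanishes at \<open>v\<close>, so \<open>v\<close> lies in its kernel.\<close>
  define w where "w = l *\<^sub>R v - M *v v"
  define b where "b = l * (w \<bullet> w) - w \<bullet> (M *v w)"
  have vS: "v \<in> S" using v by simp
  have wS: "w \<in> S" unfolding w_def by (intro subspace_diff subspace_scale S inv vS)
  have b0: "b \<ge> 0" using le [OF wS] by (simp add: b_def)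
  \<comment> \<open>Nonnegativity of the form at the perturbed point \<open>v - t w\<close>: the
    linear term in \<open>t\<close> is \<open>-2 t |w|^2\<close>, so a nonzero \<open>w\<close>
    makes the form negative for small \<open>t > 0\<close>.\<close>
  have q: "2 * t * (w \<bullet> w) \<le> t\<^sup>2 * b" for t
  proof -
    have "v - t *\<^sub>R w \<in> S" by (intro subspace_diff subspace_scale S wS vS)
    from le [OF this] have "(v - t *\<^sub>R w) \<bullet> (l *\<^sub>R (v - t *\<^sub>R w) - M *v (v - t *\<^sub>R w)) \<ge> 0"
      by (simp add: inner_diff_right)
    also have "l *\<^sub>R (v - t *\<^sub>R w) - M *v (v - t *\<^sub>R w) = w - t *\<^sub>R (l *\<^sub>R w - M *v w)"
      by (simp add: w_def matrix_vector_mult_diff_distrib matrix_vector_mult_scaleR algebra_simps)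
    also have "(v - t *\<^sub>R w) \<bullet> \<dots> = v \<bullet> w - t * (w \<bullet> w) - t * (v \<bullet> (l *\<^sub>R w - M *v w)) + t\<^sup>2 * b"
      by (simp add: b_def inner_diff_left inner_diff_right algebra_simps power2_eq_square)
    also have "v \<bullet> (l *\<^sub>R w - M *v w) = (l *\<^sub>R v - M *v v) \<bullet> w"
      by (simp add: inner_diff_left inner_diff_right symmetric_matrix_inner [OF M, of v w])
    also have "\<dots> = w \<bullet> w" by (simp add: w_def)
    also have "v \<bullet> w = 0" by (simp add: w_def inner_diff_right vv l_def)
    finally show ?thesis by simp
  qed
  have "w \<bullet> w = 0"
  proof (rule ccontr)
    assume "w \<bullet> w \<noteq> 0"
    then have p: "w \<bullet> w > 0" by simp
    show False
    proof (cases "b = 0")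
      case True then show False using q [of 1] p by simp
    next
      case False
      then have "b > 0" using b0 by simp
      \<comment> \<open>This \<open>t\<close> turns \<open>q\<close> into
        \<open>2 |w|^4 / b \<le> |w|^4 / b\<close>.\<close>
      then show False using q [of "(w \<bullet> w) / b"] p
        by (simp add: power2_eq_square field_simps mult_le_0_iff)
    qed
  qed
  then have "M *v v = l *\<^sub>R v" by (simp add: w_def)
  then show thesis using that [of v] v le by (simp add: l_def)
qed

text \<open>Extend \<open>{v, w}\<close> to a basis and list the basis vectors as columns. This is
  the change of basis that exposes a double root of the characteristic polynomial.\<close>

lemma exists_invertible_with_two_columns:
  fixes v w :: "real ^ 'k"
  assumes "independent {v, w}" "v \<noteq> w"
  obtains P :: "real ^ 'k ^ 'k" and a b where "invertible P" "a \<noteq> b" "column a P = v" "column b P = w"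
proof -
  obtain B where B: "{v, w} \<subseteq> B" "independent B" "UNIV \<subseteq> span B"
    by (rule maximal_independent_subset_extend [OF subset_UNIV assms(1)])
  have finB: "finite B" using B(2) by (rule independent_imp_finite)
  have "card B = dim (UNIV :: (real ^ 'k) set)" using basis_card_eq_dim [OF _ B(3,2)] by simp
  then have cB: "card B = card (UNIV :: 'k set)" by simp
  then obtain f where f: "bij_betw f (UNIV :: 'k set) B"
    using finite_same_card_bij [of "UNIV :: 'k set" B] finB by auto
  obtain a b where ab: "f a = v" "f b = w" using f B(1) unfolding bij_betw_def by fastforce
  define P :: "real ^ 'k ^ 'k" where "P = (\<chi> i j. f j $ i)"
  have c: "column j P = f j" for j by (simp add: column_def P_def vec_eq_iff)
  have "columns P = B" using f by (auto simp: columns_def c bij_betw_def)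
  then have "invertible P"
    using B(3) unfolding invertible_right_inverse matrix_right_invertible_span_columns span_vec_eq by auto
  then show thesis using that [of P a b] ab assms(2) c by auto
qed

text \<open>Algebraic multiplicity is at least 2 if geometric multiplicity is. With \<open>v\<close>
  and \<open>w\<close> among the columns of \<open>P\<close>, two columns of
  \<open>(t I - M) P\<close> are divisible by \<open>t - l\<close>; both factors leave the
  determinant, and \<open>det P\<close> is a nonzero constant.\<close>

lemma square_dvd_charpoly_if_independent_eigenvectors:
  fixes M :: "real ^ 'k ^ 'k"
  assumes "M *v v = l *\<^sub>R v" "M *v w = l *\<^sub>R w" "independent {v, w}" "v \<noteq> w"
  shows "[:- l, 1:]\<^sup>2 dvd charpoly M"
proof -
  obtain P :: "real ^ 'k ^ 'k" and a b
    where P: "invertible P" "a \<noteq> b" "column a P = v" "column b P = w"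
    using exists_invertible_with_two_columns [OF assms(3,4)] .
  let ?c = "\<lambda>a :: real. [:a:]"
  let ?X = "mat [:0, 1:] - map_matrix ?c M"
  let ?PP = "map_matrix ?c P"
  \<comment> \<open>Transposed because the rule \<open>det_row_mul\<close> extracts factors from
    rows.\<close>
  let ?Q = "transpose (?X ** ?PP)"
  have sum_c: "sum (\<lambda>i. ?c (g i)) S = ?c (sum g S)" for g :: "'k \<Rightarrow> real" and S
    by (induction S rule: infinite_finite_induct) auto
  have row_eig: "?Q $ j = [:- l, 1:] *s (\<chi> i. [:column j P $ i:])" if "M *v column j P = l *\<^sub>R column j P" for j
  proof -
    have "(\<Sum>k\<in>UNIV. M $ i $ k * P $ k $ j) = l * P $ i $ j" for i
      using that by (simp add: vec_eq_iff matrix_vector_mult_def column_def)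
    then have "(map_matrix ?c M ** ?PP) $ i $ j = [:l * P $ i $ j:]" for i
      by (simp add: matrix_matrix_mult_def map_matrix_def sum_c mult.commute)
    moreover have "((mat [:0, 1:] :: real poly ^ 'k ^ 'k) ** ?PP) $ i $ j = [:0, P $ i $ j:]" for i
      by (simp add: matrix_matrix_mult_def mat_def map_matrix_def if_distrib if_distribR cong: if_cong)
    moreover have "?X ** ?PP = mat [:0, 1:] ** ?PP - map_matrix ?c M ** ?PP"
      by (simp add: vec_eq_iff matrix_matrix_mult_def left_diff_distrib sum_subtractf
          del: mult_pCons_right mult_pCons_left)
    ultimately show ?thesis
      by (simp add: vec_eq_iff transpose_def column_def)
  qed
  \<comment> \<open>\<open>R\<close> is \<open>?Q\<close> with the factor \<open>t - l\<close>
    stripped from rows \<open>a\<close> and \<open>b\<close>.\<close>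
  define R where "R = (\<chi> j. if j = a then (\<chi> i. [:v $ i:]) else if j = b then (\<chi> i. [:w $ i:]) else ?Q $ j)"
  have Q: "?Q = (\<chi> j. if j = a then [:- l, 1:] *s R $ a else if j = b then [:- l, 1:] *s R $ b else R $ j)"
    using row_eig [of a] row_eig [of b] P assms(1,2) by (simp add: vec_eq_iff R_def)
  have "det ?Q = [:- l, 1:] * det (\<chi> j. if j = a then R $ a else if j = b then [:- l, 1:] *s R $ b else R $ j)"
    unfolding Q by (rule det_row_mul)
  also have "(\<chi> j. if j = a then R $ a else if j = b then [:- l, 1:] *s R $ b else R $ j)
    = (\<chi> j. if j = b then [:- l, 1:] *s R $ b else R $ j)"
    using P(2) by (simp add: vec_eq_iff)
  also have "det \<dots> = [:- l, 1:] * det (\<chi> j. if j = b then R $ b else R $ j)"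
    by (rule det_row_mul)
  finally have "det ?Q = [:- l, 1:]\<^sup>2 * det (\<chi> j. if j = b then R $ b else R $ j)"
    by (simp only: power2_eq_square mult.assoc)
  then have "[:- l, 1:]\<^sup>2 dvd det ?Q" by (rule dvdI)
  also have "det ?Q = charpoly M * det ?PP" by (simp add: det_transpose det_mul charpoly_def)
  \<comment> \<open>Embedding reals as constant polynomials is a ring homomorphism, so it commutes
    with \<open>det\<close>.\<close>
  also have "det ?PP = [:det P:]"
  proof -
    have pr: "prod (\<lambda>i. ?c (g i)) S = ?c (prod g S)" for g :: "'k \<Rightarrow> real" and S
      by (induction S rule: infinite_finite_induct) (auto simp: one_pCons)
    have "of_int (sign p) = ?c (of_int (sign p))" for p :: "'k \<Rightarrow> 'k" by (simp add: sign_def one_pCons)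
    moreover have "sum (\<lambda>i. ?c (g i)) S = ?c (sum g S)" for g :: "('k \<Rightarrow> 'k) \<Rightarrow> real" and S
      by (induction S rule: infinite_finite_induct) auto
    ultimately show ?thesis
      by (simp add: det_def map_matrix_def pr mult.commute)
  qed
  also have "charpoly M * [:det P:] = smult (det P) (charpoly M)" by simp
  finally show ?thesis using P(1) by (simp add: invertible_det_nz dvd_smult_iff)
qed

text \<open>Split a unit vector into its component along the leading eigenvector \<open>v\<close>
  and a remainder in the orthogonal complement, where the form is at most \<open>l2\<close> times
  the squared norm. Simplicity gives \<open>l2 < l1\<close>, and the ordering of
  \<open>\<sigma>\<close> bounds the stated gap by \<open>l1 - l2\<close>.\<close>

lemma spectral_gap:
  fixes M :: "real ^ 'k ^ 'k"
  assumes M: "symmetric_matrix M" and "leading_eigenvalue M l" and "simple_eigenvalue M l"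
    and \<sigma>: "ordered_eigenvalues (- M) \<sigma>" and two: "CARD('k) \<ge> 2"
  obtains v where "norm v = 1"
    "\<And>z. norm z = 1 \<Longrightarrow>
       z \<bullet> (M *v z) \<le> v \<bullet> (M *v v) - (\<sigma> (CARD('k) - 1) - \<sigma> (CARD('k))) * (1 - (z \<bullet> v)\<^sup>2)"
proof -
  let ?N = "CARD('k)"
  obtain v where v: "norm v = 1" "M *v v = (v \<bullet> (M *v v)) *\<^sub>R v"
    and vmax: "\<And>z. z \<bullet> (M *v z) \<le> (v \<bullet> (M *v v)) * (z \<bullet> z)"
    \<comment> \<open>The axis vector only witnesses that the space is nonzero.\<close>
    using Rayleigh_maximizer [OF M subspace_UNIV, of "axis undefined 1"] by (auto simp: axis_eq_0_iff)
  define l1 where "l1 = v \<bullet> (M *v v)"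
  have vv: "v \<bullet> v = 1" using v(1) by (simp add: dot_square_norm)
  have v_eig: "M *v v = l1 *\<^sub>R v" using v(2) by (simp add: l1_def)
  have ev_le: "r \<le> l1" if ev: "eigenvalue M r" for r
  proof -
    obtain w where w: "w \<noteq> 0" "M *v w = r *\<^sub>R w" using ev by (auto simp: eigenvalue_def)
    then show ?thesis using vmax [of w] by (simp add: l1_def)
  qed
  have "v \<noteq> 0" using v(1) by auto
  then have "eigenvalue M l1" using v_eig by (auto simp: eigenvalue_def)
  then have l: "l = l1" using ev_le assms(2) by (auto simp: leading_eigenvalue_def intro: antisym)
  let ?S = "{x. v \<bullet> x = 0}"
  have inv: "M *v x \<in> ?S" if "x \<in> ?S" for x
    using that symmetric_matrix_inner [OF M, of v x] v_eig by simp
  obtain u where u: "u \<noteq> 0" "orthogonal v u"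
    using orthogonal_to_vector_exists [of v] two by auto
  then have "u \<in> ?S" by (simp add: orthogonal_def)
  from Rayleigh_maximizer [OF M subspace_hyperplane inv this u(1)]
  obtain w where w: "v \<bullet> w = 0" "norm w = 1" "M *v w = (w \<bullet> (M *v w)) *\<^sub>R w"
    and wmax: "\<And>z. v \<bullet> z = 0 \<Longrightarrow> z \<bullet> (M *v z) \<le> (w \<bullet> (M *v w)) * (z \<bullet> z)"
    by auto
  define l2 where "l2 = w \<bullet> (M *v w)"
  have w_eig: "M *v w = l2 *\<^sub>R w" using w(3) by (simp add: l2_def)
  have "w \<noteq> 0" using w(2) by auto
  then have ev2: "eigenvalue M l2" using w_eig by (auto simp: eigenvalue_def)
  have "l1 \<noteq> l2"
  proof
    assume "l1 = l2"
    have "v \<noteq> w" using w(1) vv by auto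
    moreover have "independent {v, w}"
      by (rule pairwise_orthogonal_independent)
        (use w(1) \<open>v \<noteq> 0\<close> \<open>w \<noteq> 0\<close> in \<open>auto simp: pairwise_def orthogonal_def inner_commute\<close>)
    ultimately have "[:- l1, 1:]\<^sup>2 dvd charpoly M"
      using square_dvd_charpoly_if_independent_eigenvectors [OF v_eig] w_eig \<open>l1 = l2\<close> by auto
    \<comment> \<open>\<open>l1 + 1\<close> exceeds every eigenvalue, so it is not a root;
      \<open>order_divides\<close> then yields a genuine bound on the order.\<close>
    moreover have "charpoly M \<noteq> 0"
      using charpoly_root_iff [of M "l1 + 1"] ev_le [of "l1 + 1"] by auto
    ultimately have "2 \<le> order l1 (charpoly M)" by (simp add: order_divides)
    then show False using assms(3) l by (simp add: simple_eigenvalue_def)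
  qed
  then have l21: "l2 < l1" using ev_le [OF ev2] by simp
  have "(- M) *v x = - (M *v x)" for x
    by (simp add: vec_eq_iff matrix_vector_mult_def sum_negf)
  then have "(- M) *v x = r *\<^sub>R x \<longleftrightarrow> M *v x = (- r) *\<^sub>R x" for r x
    by (metis minus_equation_iff scaleR_minus_left)
  then have neg: "eigenvalue (- M) r \<longleftrightarrow> eigenvalue M (- r)" for r
    by (simp add: eigenvalue_def)
  have root: "eigenvalue M (- r) \<longleftrightarrow> (\<exists>i. 1 \<le> i \<and> i \<le> ?N \<and> \<sigma> i = r)" for r
  proof -
    have "poly (charpoly (- M)) r = (\<Prod>i = 1..?N. r - \<sigma> i)"
      using \<sigma> by (simp add: ordered_eigenvalues_def poly_prod)
    then have "eigenvalue (- M) r \<longleftrightarrow> (\<exists>i\<in>{1..?N}. r = \<sigma> i)"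
      by (simp add: charpoly_root_iff [symmetric])
    then show ?thesis by (auto simp: neg)
  qed
  have anti: "\<sigma> j \<le> \<sigma> i" if "1 \<le> i" "i \<le> j" "j \<le> ?N" for i j
    using \<sigma> that by (auto simp: ordered_eigenvalues_def)
  have s1: "- l1 \<le> \<sigma> ?N" using ev_le [of "- \<sigma> ?N"] root [of "\<sigma> ?N"] two by fastforce
  obtain j where j: "1 \<le> j" "j \<le> ?N" "\<sigma> j = - l2" using root [of "- l2"] ev2 by auto
  obtain i where i: "1 \<le> i" "i \<le> ?N" "\<sigma> i = - l1" using root [of "- l1"] \<open>eigenvalue M l1\<close> by auto
  \<comment> \<open>Since \<open>- l2 > - l1\<close>, the index of \<open>- l2\<close> strictly
    precedes that of \<open>- l1\<close>, so it is at most \<open>?N - 1\<close>.\<close>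
  have "j < i" using anti [of i j] i j l21 by force
  then have s2: "\<sigma> (?N - 1) \<le> - l2" using anti [of j "?N - 1"] i(2) j by simp
  have "z \<bullet> (M *v z) \<le> l1 - (\<sigma> (?N - 1) - \<sigma> ?N) * (1 - (z \<bullet> v)\<^sup>2)" if z: "norm z = 1" for z
  proof -
    define c where "c = z \<bullet> v"
    define y where "y = z - c *\<^sub>R v"
    have zy: "z = c *\<^sub>R v + y" by (simp add: y_def)
    have vy: "v \<bullet> y = 0" by (simp add: y_def inner_diff_right vv c_def inner_commute)
    have vMy: "v \<bullet> (M *v y) = 0" using inv vy by simp
    have "z \<bullet> z = c\<^sup>2 + y \<bullet> y"
      unfolding zy using vy by (simp add: inner_add_left inner_add_right vv inner_commute power2_eq_square)
    then have yy: "y \<bullet> y = 1 - c\<^sup>2" using z by (simp add: dot_square_norm)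
    have "z \<bullet> (M *v z) = c\<^sup>2 * l1 + y \<bullet> (M *v y)"
      unfolding zy using vy vMy
      by (simp add: matrix_vector_right_distrib matrix_vector_mult_scaleR v_eig vv inner_add_left
          inner_add_right inner_commute power2_eq_square)
    also have "\<dots> \<le> c\<^sup>2 * l1 + l2 * (1 - c\<^sup>2)" using wmax [OF vy] by (simp add: l2_def yy)
    also have "\<dots> = l1 - (l1 - l2) * (1 - c\<^sup>2)" by (simp add: algebra_simps)
    \<comment> \<open>Replacing \<open>l1 - l2\<close> by the smaller gap is allowed because
      \<open>1 - c^2 = |y|^2 \<ge> 0\<close>.\<close>
    also have "\<dots> \<le> l1 - (\<sigma> (?N - 1) - \<sigma> ?N) * (1 - c\<^sup>2)"
      using s1 s2 yy [symmetric] inner_ge_zero [of y] by (intro diff_left_mono mult_right_mono) auto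
    finally show ?thesis by (simp add: c_def)
  qed
  then show thesis using that [of v] v(1) by (simp add: l1_def)
qed

section \<open>Rank-one matrices, the set \<open>C_set\<close> and tensor squares\<close>

text \<open>Rank one makes all rows multiples \<open>w i\<close> of one vector \<open>u\<close>,
  symmetry makes the coefficients proportional to \<open>u\<close>, and trace 1 fixes the factor as
  \<open>1 / |u|^2\<close>. Its positivity is what permits a real square.\<close>

lemma rank_one_symmetric_trace_one:
  fixes M :: "real ^ 'k ^ 'k"
  assumes "rank M = 1" "symmetric_matrix M" "trace M = 1"
  obtains z where "norm z = 1" "\<And>r c. M $ r $ c = z $ r * z $ c"
proof -
  obtain B where B: "independent B" "rows M \<subseteq> span B" "card B = 1"
    using basis_exists [of "rows M"] assms(1) by (metis row_rank_def)
  then obtain u where u: "B = {u}" by (auto simp: card_1_singleton_iff)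
  then have u0: "u \<noteq> 0" using B(1) dependent_zero by blast
  have "\<exists>k. M $ i = k *\<^sub>R u" for i
    using B(2) unfolding u span_singleton rows_def row_def by auto
  then obtain w where w: "\<And>i. M $ i = w i *\<^sub>R u" by metis
  have sym: "w j * u $ i = w i * u $ j" for i j
    using assms(2) w unfolding symmetric_matrix_def transpose_def vec_eq_iff by simp
  have tr: "(\<Sum>j\<in>UNIV. w j * u $ j) = 1" using assms(3) w by (simp add: trace_def)
  have "w i * (u \<bullet> u) = u $ i" for i
  proof -
    have "w i * (u \<bullet> u) = (\<Sum>j\<in>UNIV. (w i * u $ j) * u $ j)"
      by (simp add: inner_vec_def sum_distrib_left mult.assoc)
    also have "\<dots> = (\<Sum>j\<in>UNIV. w j * u $ j) * u $ i"
      unfolding sym [symmetric] by (simp add: sum_distrib_left mult_ac)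
    finally show ?thesis by (simp add: tr)
  qed
  then have "w i = u $ i / (norm u * norm u)" for i
    using u0 by (simp add: field_simps norm_eq_sqrt_inner)
  then have "M $ r $ c = ((1 / norm u) *\<^sub>R u) $ r * ((1 / norm u) *\<^sub>R u) $ c" for r c
    by (simp add: w)
  then show thesis using that [of "(1 / norm u) *\<^sub>R u"] u0 by simp
qed

lemma rank_outer_product:
  fixes z :: "real ^ 'k"
  assumes "z \<noteq> 0" "\<And>r c. M $ r $ c = z $ r * z $ c"
  shows "rank M = 1"
proof -
  have "rows M \<subseteq> span {z}"
    using assms(2) by (auto simp: rows_def row_def span_singleton vec_eq_iff)
  then have "rank M \<le> 1"
    using dim_le_card [of "rows M" "{z}"] by (simp add: row_rank_def)
  moreover have "M \<noteq> 0" using assms by (auto simp: vec_eq_iff)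
  then have "rank M \<noteq> 0" by (simp add: rank_eq_0)
  ultimately show ?thesis by simp
qed

definition tensor_square :: "real ^ ('m \<Rightarrow> 'n) \<Rightarrow> ('n::finite, 'm::finite + 'm) tensor" where
  "tensor_square z = (\<chi> i. z $ (i \<circ> Inl) * z $ (i \<circ> Inr))"

lemma Mat_tensor_square: "Mat (tensor_square z) $ r $ c = z $ r * z $ c"
  by (simp add: Mat_def tensor_square_def o_def)

lemma Mat_inject: "Mat A = Mat B \<longleftrightarrow> A = B"
proof
  assume "Mat A = Mat B"
  then have "A $ case_sum (i \<circ> Inl) (i \<circ> Inr) = B $ case_sum (i \<circ> Inl) (i \<circ> Inr)" for i
    by (simp add: Mat_def vec_eq_iff)
  then show "A = B" by (simp add: vec_eq_iff surjective_sum o_def)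
qed simp

lemma C_set_eq:
  "(C_set :: ('n::finite, 'm::finite + 'm) tensor set) = tensor_square ` sphere 0 1"
proof (intro equalityI subsetI)
  fix X :: "('n, 'm + 'm) tensor"
  assume "X \<in> C_set"
  then obtain z where "norm z = 1" "\<And>r c. Mat X $ r $ c = z $ r * z $ c"
    using rank_one_symmetric_trace_one [of "Mat X"] by (auto simp: C_set_def)
  then have "Mat X = Mat (tensor_square z)" by (simp add: vec_eq_iff Mat_tensor_square)
  then show "X \<in> tensor_square ` sphere 0 1" using \<open>norm z = 1\<close> by (auto simp: Mat_inject)
next
  fix X :: "('n, 'm + 'm) tensor"
  assume "X \<in> tensor_square ` sphere 0 1"
  then obtain z where z: "norm z = 1" "X = tensor_square z" by auto
  have "trace (Mat X) = z \<bullet> z" by (simp add: trace_def z Mat_tensor_square inner_vec_def)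
  then have "trace (Mat X) = 1" using z by (simp add: dot_square_norm)
  moreover have "rank (Mat X) = 1"
    unfolding z(2) using z(1) by (intro rank_outer_product [of z] Mat_tensor_square) auto
  moreover have "symmetric_matrix (Mat X)"
    by (simp add: symmetric_matrix_def transpose_def vec_eq_iff z Mat_tensor_square mult.commute)
  ultimately show "X \<in> C_set" by (simp add: C_set_def)
qed

lemma inner_Mat:
  fixes A B :: "('n::finite, 'm::finite + 'm) tensor"
  shows "A \<bullet> B = (\<Sum>r\<in>UNIV. \<Sum>c\<in>UNIV. Mat A $ r $ c * Mat B $ r $ c)"
proof -
  have "bij_betw (\<lambda>(r, c). case_sum r c) UNIV (UNIV :: ('m + 'm \<Rightarrow> 'n) set)"
    by (rule bij_betw_byWitness [where f' = "\<lambda>i. (i \<circ> Inl, i \<circ> Inr)"])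
      (auto simp: o_def surjective_sum)
  then have "A \<bullet> B = (\<Sum>(r, c)\<in>UNIV. A $ case_sum r c * B $ case_sum r c)"
    unfolding inner_vec_def inner_real_def
    by (subst sum.reindex_bij_betw [symmetric]) (simp_all add: case_prod_unfold)
  then show ?thesis by (simp add: Mat_def sum.cartesian_product)
qed

lemma inner_tensor_square: "A \<bullet> tensor_square z = z \<bullet> (Mat A *v z)"
  by (simp add: inner_Mat Mat_tensor_square inner_vec_def matrix_vector_mult_def sum_distrib_left mult_ac)

lemma inner_tensor_squares: "tensor_square x \<bullet> tensor_square z = (x \<bullet> z)\<^sup>2"
  by (simp add: inner_Mat Mat_tensor_square inner_vec_def power2_eq_square sum_product mult_ac)

lemma tensor_square_scaleR: "tensor_square (c *\<^sub>R z) = c\<^sup>2 *\<^sub>R tensor_square z"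
  by (simp add: tensor_square_def vec_eq_iff power2_eq_square)

section \<open>Symmetric tensors and symmetrization\<close>

text \<open>Transposing \<open>Mat B\<close> amounts to one permutation of the positions, the swap
  \<open>p\<close> of the two halves. Hence every point feasible for (O) lies in
  \<open>C_set\<close>.\<close>

lemma symmetric_tensors_Mat:
  fixes B :: "('n::finite, 'm::finite + 'm) tensor"
  assumes "B \<in> symmetric_tensors"
  shows "symmetric_matrix (Mat B)"
proof -
  define p where "p = (case_sum Inr Inl :: 'm + 'm \<Rightarrow> 'm + 'm)"
  have pp: "p \<circ> p = id" by (auto simp: p_def fun_eq_iff split: sum.split)
  have "p permutes UNIV" by (simp add: permutes_univ) (metis pp comp_apply id_apply)
  then have "B $ (i \<circ> p) = B $ i" for i using assms by (simp add: symmetric_tensors_def)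
  moreover have "case_sum r c \<circ> p = case_sum c r" for r c :: "'m \<Rightarrow> 'n"
    by (auto simp: p_def fun_eq_iff split: sum.split)
  ultimately have "B $ case_sum c r = B $ case_sum r c" for r c by metis
  then show ?thesis by (simp add: symmetric_matrix_def transpose_def vec_eq_iff Mat_def)
qed

lemma Sym_nth: "Sym B $ i = (\<Sum>p | p permutes (UNIV :: 'd set). B $ (i \<circ> p)) / fact CARD('d)"
  for B :: "('n::finite, 'd::finite) tensor"
  by (simp add: Sym_def)

lemma linear_Sym: "linear Sym"
  by (rule linearI) (simp_all add: vec_eq_iff Sym_nth sum.distrib add_divide_distrib sum_distrib_left)

lemma Sym_in_symmetric_tensors:
  fixes B :: "('n::finite, 'd::finite) tensor"
  shows "Sym B \<in> symmetric_tensors"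
  unfolding symmetric_tensors_def
proof (clarify)
  fix p :: "'d \<Rightarrow> 'd" and i :: "'d \<Rightarrow> 'n" assume p: "p permutes UNIV"
  show "Sym B $ (i \<circ> p) = Sym B $ i"
    unfolding Sym_nth o_assoc [symmetric]
    using setum_permutations_compose_left [OF p, of "\<lambda>q. B $ (i \<circ> q)"] by simp
qed

lemma Sym_fixes_symmetric_tensors: "B \<in> symmetric_tensors \<Longrightarrow> Sym B = B"
  by (simp add: vec_eq_iff Sym_nth symmetric_tensors_def card_permutations [OF refl])

text \<open>\<open>Sym\<close> acts as the orthogonal projection: moving a permutation from
  \<open>B\<close> onto the invariant \<open>Z\<close> leaves each summand equal to
  \<open>B \<bullet> Z\<close>.\<close>

lemma Sym_inner:
  fixes Z :: "('n::finite, 'd::finite) tensor"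
  assumes Z: "Z \<in> symmetric_tensors"
  shows "Sym B \<bullet> Z = B \<bullet> Z"
proof -
  have p: "(\<Sum>i\<in>UNIV. B $ (i \<circ> p) * Z $ i) = B \<bullet> Z" if p: "p permutes UNIV" for p
  proof -
    have "bij_betw (\<lambda>i. i \<circ> p) (UNIV :: ('d \<Rightarrow> 'n) set) UNIV"
      by (rule bij_betw_byWitness [where f' = "\<lambda>i. i \<circ> inv p"])
        (auto simp: o_assoc [symmetric] permutes_inv_o [OF p])
    then have "(\<Sum>i\<in>UNIV. B $ (i \<circ> p) * Z $ (i \<circ> p)) = B \<bullet> Z"
      unfolding inner_vec_def inner_real_def by (rule sum.reindex_bij_betw)
    then show ?thesis using Z p by (simp add: symmetric_tensors_def)
  qed
  have "Sym B \<bullet> Z = (\<Sum>i\<in>UNIV. \<Sum>p | p permutes (UNIV :: 'd set). B $ (i \<circ> p) * Z $ i) / fact CARD('d)"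
    by (simp add: inner_vec_def Sym_nth sum_distrib_right sum_divide_distrib)
  also have "\<dots> = (\<Sum>p | p permutes (UNIV :: 'd set). B \<bullet> Z) / fact CARD('d)"
    by (subst sum.swap) (simp add: p)
  also have "\<dots> = B \<bullet> Z" by (simp add: card_permutations [OF refl])
  finally show ?thesis .
qed

section \<open>Lyapunov descent\<close>

text \<open>\<open>V\<close> is eventually decreasing and bounded below, so its decrements tend to
  0, and they dominate \<open>c * a (Suc k)\<close>. The offset \<open>K\<close> allows for initial
  steps without descent.\<close>

lemma tendsto_0_if_Lyapunov:
  fixes V a :: "nat \<Rightarrow> real"
  assumes "c > 0" and V0: "\<And>k. V k \<ge> 0" and a0: "\<And>k. a k \<ge> 0"
    and step: "\<And>k. k \<ge> K \<Longrightarrow> V (Suc k) + c * a (Suc k) \<le> V k"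
  shows "a \<longlonglongrightarrow> 0"
proof -
  have ca: "c * a (Suc k) \<ge> 0" for k using \<open>c > 0\<close> a0 by simp
  have "V (Suc k + K) \<le> V (k + K)" for k using step [of "k + K"] ca [of "k + K"] by simp
  then have "decseq (\<lambda>k. V (k + K))" by (intro decseq_SucI) simp
  then obtain l where "(\<lambda>k. V (k + K)) \<longlonglongrightarrow> l"
    using decseq_convergent [of "\<lambda>k. V (k + K)" 0] V0 by blast
  then have V: "V \<longlonglongrightarrow> l" by (rule LIMSEQ_offset)
  then have "(\<lambda>k. (V k - V (Suc k)) / c) \<longlonglongrightarrow> (l - l) / c"
    using \<open>c > 0\<close> by (intro tendsto_intros LIMSEQ_Suc) auto
  moreover have "\<forall>\<^sub>F k in sequentially. a (Suc k) \<le> (V k - V (Suc k)) / c"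
    using eventually_ge_at_top [of K]
    by eventually_elim (use step \<open>c > 0\<close> in \<open>simp add: field_simps\<close>)
  ultimately have "(\<lambda>k. a (Suc k)) \<longlonglongrightarrow> 0"
    using tendsto_sandwich [OF always_eventually [OF allI [OF a0]] _ tendsto_const] by simp
  then show ?thesis by (rule LIMSEQ_imp_Suc)
qed

text \<open>All variables stand for errors relative to the limit: \<open>x\<close> for the new
  \<open>X\<close>, \<open>y\<close> and \<open>y'\<close> for the old and new \<open>Y\<close>,
  \<open>\<Lambda>\<close> and \<open>\<Lambda>'\<close> for the multipliers. The hypotheses
  \<open>orth\<close> record that \<open>y'\<close> is the symmetric part of \<open>x\<close> and
  that \<open>\<Lambda>\<close> is orthogonal to symmetric tensors.\<close>

lemma Lyapunov_step:
  fixes x y y' \<Lambda> \<Lambda>' :: "'a::real_inner"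
  assumes "\<tau> > 0" and \<Lambda>': "\<Lambda>' = \<Lambda> - \<tau> *\<^sub>R (x - y')"
    and orth: "\<Lambda> \<bullet> y' = 0" "x \<bullet> y' = y' \<bullet> y'" "x \<bullet> y = y' \<bullet> y"
    and growth: "(\<delta> + \<tau>) / 2 * (norm x)\<^sup>2 \<le> (\<Lambda> + \<tau> *\<^sub>R y) \<bullet> x"
  shows "(norm \<Lambda>')\<^sup>2 / (2 * \<tau>) + \<tau> / 2 * (norm y')\<^sup>2 + (\<delta> - \<tau>) / 2 * (norm x)\<^sup>2
    \<le> (norm \<Lambda>)\<^sup>2 / (2 * \<tau>) + \<tau> / 2 * (norm y)\<^sup>2"
proof -
  define r where "r = x - y'"
  have ry': "r \<bullet> y' = 0" and \<Lambda>r: "\<Lambda> \<bullet> r = \<Lambda> \<bullet> x"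
    using orth by (simp_all add: r_def inner_diff_left inner_diff_right)
  have xx: "(norm x)\<^sup>2 = (norm y')\<^sup>2 + (norm r)\<^sup>2"
    using orth by (simp add: r_def power2_norm_eq_inner inner_diff_left inner_diff_right inner_commute)
  have "(norm \<Lambda>')\<^sup>2 = (norm \<Lambda>)\<^sup>2 - 2 * \<tau> * (\<Lambda> \<bullet> x) + \<tau>\<^sup>2 * (norm r)\<^sup>2"
    unfolding \<Lambda>' r_def [symmetric] power2_norm_eq_inner \<Lambda>r [symmetric]
    by (simp add: inner_diff_left inner_diff_right inner_commute power2_eq_square algebra_simps)
  then have N: "(norm \<Lambda>')\<^sup>2 / (2 * \<tau>) = (norm \<Lambda>)\<^sup>2 / (2 * \<tau>) - \<Lambda> \<bullet> x + \<tau> / 2 * (norm r)\<^sup>2"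
    using \<open>\<tau> > 0\<close> by (simp add: field_simps power2_eq_square)
  \<comment> \<open>Passing from \<open>x\<close> to its projection \<open>y'\<close> first makes
    the cross term cost \<open>|y'|^2\<close> instead of \<open>|x|^2\<close>; the remaining
    \<open>\<tau>/2 |r|^2\<close> is then dropped.\<close>
  have "y \<bullet> x = y \<bullet> y'" using orth(3) by (simp add: inner_commute)
  also have "2 * \<dots> \<le> (norm y)\<^sup>2 + (norm y')\<^sup>2"
    using inner_ge_zero [of "y - y'"]
    by (simp add: power2_norm_eq_inner inner_diff_left inner_diff_right inner_commute)
  finally have "\<tau> * (y \<bullet> x) \<le> \<tau> * (((norm y)\<^sup>2 + (norm y')\<^sup>2) / 2)"
    using \<open>\<tau> > 0\<close> by (intro mult_left_mono) auto
  moreover have "0 \<le> \<tau> / 2 * (norm r)\<^sup>2" using \<open>\<tau> > 0\<close> by simp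
  ultimately show ?thesis
    using growth unfolding N xx by (simp add: inner_add_left algebra_simps add_divide_distrib diff_divide_distrib)
qed

section \<open>Global optimality and convergence of the iterates\<close>

theorem theorem3p3:
  fixes A Xs Ys Ls :: "('n::finite, 'm::finite + 'm) tensor"
    and X Y L :: "nat \<Rightarrow> ('n, 'm + 'm) tensor"
    and \<tau> :: real and \<sigma> :: "nat \<Rightarrow> real" and N :: nat
  assumes "CARD('n) \<ge> 2"
    and "A \<in> symmetric_tensors"
    and "\<tau> > 0"
    and "nonconvex_ADMM A \<tau> X Y L"
    and "Xs \<in> C_set" and "Ys \<in> symmetric_tensors"
    and "\<forall>Z \<in> C_set. (- Ls - \<tau> *\<^sub>R Ys) \<bullet> (Z - Xs) \<ge> 0"
    and "Sym Ls = A"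
    and "Xs = Ys"
    and "symmetric_matrix (Mat Ls)"
    and "\<exists>l. leading_eigenvalue (Mat Ls) l \<and> simple_eigenvalue (Mat Ls) l"
    and "N = CARD('n) ^ CARD('m)"
    and "ordered_eigenvalues (- Mat Ls) \<sigma>"
    and "\<tau> < \<sigma> (N - 1) - \<sigma> N"
  shows "X \<longlonglongrightarrow> Xs \<and> Y \<longlonglongrightarrow> Ys \<and> Xs = Ys \<and> O_global_optimizer A Xs"
proof -
  define \<delta> where "\<delta> = \<sigma> (N - 1) - \<sigma> N"
  have \<tau>\<delta>: "0 < \<tau>" "\<tau> < \<delta>" using assms(3,14) by (simp_all add: \<delta>_def)
  have N: "N = CARD('m \<Rightarrow> 'n)" by (simp add: card_fun assms(12))
  have "2 \<le> CARD('n) ^ CARD('m)"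
    using assms(1) self_le_power [of "CARD('n)" "CARD('m)"] zero_less_card_finite [where 'a = 'm] by linarith
  then have two: "CARD('m \<Rightarrow> 'n) \<ge> 2" using N assms(12) by simp
  obtain v where v: "norm v = 1"
    and gap: "\<And>z. norm z = 1 \<Longrightarrow>
      z \<bullet> (Mat Ls *v z) \<le> v \<bullet> (Mat Ls *v v) - \<delta> * (1 - (z \<bullet> v)\<^sup>2)"
    using assms(10,11,13) two spectral_gap [of "Mat Ls"] unfolding \<delta>_def N by metis
  have vv: "v \<bullet> v = 1" using v by (simp add: dot_square_norm)

  obtain x where x: "norm x = 1" "Xs = tensor_square x" using assms(5) by (auto simp: C_set_eq)
  have xx: "x \<bullet> x = 1" using x by (simp add: dot_square_norm)
  \<comment> \<open>Testing the optimality condition at the leading eigenvector identifies \<open>x\<close> with it, since \<open>\<tau> < \<delta>\<close>.\<close>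
  have "(- Ls - \<tau> *\<^sub>R Xs) \<bullet> (tensor_square v - Xs) \<ge> 0"
    using assms(7,9) v by (simp add: C_set_eq)
  then have "v \<bullet> (Mat Ls *v v) + \<tau> * (x \<bullet> v)\<^sup>2 \<le> x \<bullet> (Mat Ls *v x) + \<tau>"
    by (simp add: inner_diff_left inner_diff_right x(2) inner_tensor_squares xx)
      (simp add: inner_tensor_square)
  then have "(\<delta> - \<tau>) * (1 - (x \<bullet> v)\<^sup>2) \<le> 0" using gap [OF x(1)] by (simp add: algebra_simps)
  then have "1 - (x \<bullet> v)\<^sup>2 \<le> 0" using \<tau>\<delta> by (simp add: mult_le_0_iff)
  \<comment> \<open>The equality case of Cauchy-Schwarz: the squared distance from \<open>x\<close>
    to the line of \<open>v\<close> vanishes, so \<open>x\<close> is \<open>v\<close> up to sign,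
    and the sign disappears in the tensor square.\<close>
  moreover have "norm (x - (x \<bullet> v) *\<^sub>R v) ^ 2 = 1 - (x \<bullet> v)\<^sup>2"
    unfolding power2_norm_eq_inner
    by (simp add: inner_diff_left inner_diff_right xx vv inner_commute power2_eq_square)
  ultimately have c2: "(x \<bullet> v)\<^sup>2 = 1" and "norm (x - (x \<bullet> v) *\<^sub>R v) ^ 2 = 0"
    using zero_le_power2 [of "norm (x - (x \<bullet> v) *\<^sub>R v)"] by linarith+
  then have "x = (x \<bullet> v) *\<^sub>R v" by simp
  then have "Xs = ((x \<bullet> v)\<^sup>2) *\<^sub>R tensor_square v"
    unfolding x(2) by (metis (no_types, lifting) tensor_square_scaleR)
  then have Xs: "Xs = tensor_square v" using c2 by simp

  \<comment> \<open>Members of \<open>C_set\<close> have norm 1, so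
    \<open>|Z - Xs|^2 = 2 (1 - (z \<bullet> v)^2)\<close>; this converts the spectral gap into
    quadratic growth.\<close>
  have inner_Xs: "Z \<bullet> Xs - 1 = - (norm (Z - Xs))\<^sup>2 / 2"
    and Ls_growth: "\<delta> / 2 * (norm (Z - Xs))\<^sup>2 \<le> Ls \<bullet> (Xs - Z)" if Z: "Z \<in> C_set" for Z
  proof -
    obtain z where z: "norm z = 1" "Z = tensor_square z" using Z by (auto simp: C_set_eq)
    have zz: "z \<bullet> z = 1" using z by (simp add: dot_square_norm)
    have n: "(norm (Z - Xs))\<^sup>2 = 2 * (1 - (z \<bullet> v)\<^sup>2)"
      by (simp add: power2_norm_eq_inner inner_diff_left inner_diff_right z(2) Xs inner_tensor_squares zz vv
          inner_commute)
    show "Z \<bullet> Xs - 1 = - (norm (Z - Xs))\<^sup>2 / 2"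
      unfolding n by (simp add: z(2) Xs inner_tensor_squares)
    show "\<delta> / 2 * (norm (Z - Xs))\<^sup>2 \<le> Ls \<bullet> (Xs - Z)"
      unfolding n using gap [OF z(1)] by (simp add: right_diff_distrib inner_diff_right Xs z(2) inner_tensor_square)
  qed

  have symXs: "Xs \<in> symmetric_tensors" using assms(6,9) by simp
  have opt: "O_global_optimizer A Xs"
    unfolding O_global_optimizer_def is_arg_max_linorder
  proof (intro conjI allI impI)
    show "O_feasible Xs" using symXs assms(5) by (simp add: O_feasible_def C_set_def)
  next
    fix Z :: "('n, 'm + 'm) tensor"
    assume Z: "O_feasible Z"
    then have sZ: "Z \<in> symmetric_tensors" by (simp add: O_feasible_def)
    have "Z \<in> C_set" using Z symmetric_tensors_Mat [OF sZ] by (simp add: O_feasible_def C_set_def)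
    have "0 \<le> \<delta> / 2 * (norm (Z - Xs))\<^sup>2" using \<tau>\<delta> by simp
    then have "Ls \<bullet> Z \<le> Ls \<bullet> Xs" using Ls_growth [OF \<open>Z \<in> C_set\<close>] by (simp add: inner_diff_right)
    \<comment> \<open>On symmetric tensors \<open>A = Sym Ls\<close> and \<open>Ls\<close> define
      the same functional.\<close>
    then show "A \<bullet> Z \<le> A \<bullet> Xs" using Sym_inner [OF sZ, of Ls] Sym_inner [OF symXs, of Ls] assms(8) by simp
  qed

  note Sym_simps = linear_add [OF linear_Sym] linear_diff [OF linear_Sym] linear_scale [OF linear_Sym]
  have "is_arg_max (\<lambda>Z. (L k + \<tau> *\<^sub>R Y k) \<bullet> Z) (\<lambda>Z. Z \<in> C_set) (X (Suc k))"
    and Y: "Y (Suc k) = (1 / \<tau>) *\<^sub>R Sym (A - L k + \<tau> *\<^sub>R X (Suc k))"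
    and L: "L (Suc k) = L k - \<tau> *\<^sub>R (X (Suc k) - Y (Suc k))" for k
    using assms(4) by (auto simp: nonconvex_ADMM_def)
  then have XC: "X (Suc k) \<in> C_set" and Xopt: "(L k + \<tau> *\<^sub>R Y k) \<bullet> Xs \<le> (L k + \<tau> *\<^sub>R Y k) \<bullet> X (Suc k)" for k
    using assms(5) by (auto simp: is_arg_max_linorder)
  have Y_sym: "Y k \<in> symmetric_tensors" for k
  proof (cases k)
    case 0 then show ?thesis using assms(4) by (simp add: nonconvex_ADMM_def)
  next
    case (Suc j)
    have "Y (Suc j) = Sym ((1 / \<tau>) *\<^sub>R (A - L j + \<tau> *\<^sub>R X (Suc j)))"
      unfolding Y by (simp only: linear_scale [OF linear_Sym])
    then show ?thesis using Suc Sym_in_symmetric_tensors by metis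
  qed
  have SymA: "Sym A = A" by (rule Sym_fixes_symmetric_tensors [OF assms(2)])
  have \<tau>Y: "\<tau> *\<^sub>R Y (Suc k) = A - Sym (L k) + \<tau> *\<^sub>R Sym (X (Suc k))" for k
    using \<tau>\<delta> by (simp add: Y Sym_simps SymA)
  \<comment> \<open>In the multiplier update the contributions of \<open>L k\<close> and
    \<open>X (Suc k)\<close> cancel after symmetrization, whatever \<open>L 0\<close> was.\<close>
  have SymL: "Sym (L (Suc k)) = A" for k
    unfolding L by (simp add: Sym_simps SymA Sym_fixes_symmetric_tensors [OF Sym_in_symmetric_tensors] scaleR_diff_right \<tau>Y)
  \<comment> \<open>With \<open>Sym (L (Suc k)) = A\<close> the first two terms of
    \<open>\<tau>Y\<close> cancel, so this holds from the second iterate on.\<close>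
  have YX: "Y (Suc (Suc k)) = Sym (X (Suc (Suc k)))" for k
    using \<tau>Y [of "Suc k"] \<tau>\<delta> by (simp add: SymL)

  define V where "V k = (norm (L k - Ls))\<^sup>2 / (2 * \<tau>) + \<tau> / 2 * (norm (Y k - Xs))\<^sup>2" for k
  \<comment> \<open>\<open>k \<ge> 1\<close> is what makes \<open>SymL\<close> available for
    \<open>L k\<close> and \<open>YX\<close> for \<open>Y (Suc k)\<close>.\<close>
  have step: "V (Suc k) + (\<delta> - \<tau>) / 2 * (norm (X (Suc k) - Xs))\<^sup>2 \<le> V k" if k1: "k \<ge> 1" for k
    unfolding V_def
  proof (rule Lyapunov_step)
    obtain j where k: "k = Suc j" using k1 by (cases k) auto
    have sym: "S - Xs \<in> symmetric_tensors" if "S \<in> symmetric_tensors" for S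
      using that symXs by (auto simp: symmetric_tensors_def)
    have SymX: "Sym (X (Suc k) - Xs) = Y (Suc k) - Xs"
      by (simp add: Sym_simps Sym_fixes_symmetric_tensors [OF symXs] YX k)
    show "(L k - Ls) \<bullet> (Y (Suc k) - Xs) = 0"
      using Sym_inner [OF sym [OF Y_sym], of "L k - Ls" "Suc k"] by (simp add: Sym_simps SymL k assms(8))
    show "(X (Suc k) - Xs) \<bullet> (Y (Suc k) - Xs) = (Y (Suc k) - Xs) \<bullet> (Y (Suc k) - Xs)"
      using Sym_inner [OF sym [OF Y_sym], of "X (Suc k) - Xs" "Suc k"] SymX by simp
    show "(X (Suc k) - Xs) \<bullet> (Y k - Xs) = (Y (Suc k) - Xs) \<bullet> (Y k - Xs)"
      using Sym_inner [OF sym [OF Y_sym], of "X (Suc k) - Xs" k] SymX by simp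
    show "L (Suc k) - Ls = L k - Ls - \<tau> *\<^sub>R (X (Suc k) - Xs - (Y (Suc k) - Xs))" by (simp add: L)
    have "Xs \<bullet> Xs = 1" by (simp add: Xs inner_tensor_squares vv)
    then have "\<tau> * (Xs \<bullet> (X (Suc k) - Xs)) = - \<tau> * (norm (X (Suc k) - Xs))\<^sup>2 / 2"
      using inner_Xs [OF XC, of k] by (simp add: inner_diff_right inner_commute)
    \<comment> \<open>Three contributions: optimality of \<open>X (Suc k)\<close> gives at least 0,
      growth of \<open>Ls\<close> gives the \<open>\<delta>/2\<close> part, and
      \<open>- \<tau> Xs\<close> gives exactly the \<open>\<tau>/2\<close> part.\<close>
    then show "(\<delta> + \<tau>) / 2 * (norm (X (Suc k) - Xs))\<^sup>2 \<le> (L k - Ls + \<tau> *\<^sub>R (Y k - Xs)) \<bullet> (X (Suc k) - Xs)"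
      using Xopt [of k] Ls_growth [OF XC, of k]
      by (simp add: inner_diff_left inner_diff_right inner_add_left algebra_simps add_divide_distrib)
  qed (use \<tau>\<delta> in auto)
  \<comment> \<open>\<open>K = 1\<close> skips the step from 0; the arbitrary \<open>X 0\<close>
    enters only as the term at index 0 and does not affect the limit.\<close>
  have "(\<lambda>k. (norm (X k - Xs))\<^sup>2) \<longlonglongrightarrow> 0"
    by (rule tendsto_0_if_Lyapunov [where c = "(\<delta> - \<tau>) / 2" and V = V and K = 1])
      (use \<tau>\<delta> step in \<open>auto simp: V_def\<close>)
  from tendsto_real_sqrt [OF this] have "(\<lambda>k. norm (X k - Xs)) \<longlonglongrightarrow> 0" by simp
  then have X: "X \<longlonglongrightarrow> Xs" unfolding tendsto_norm_zero_iff LIM_zero_iff .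
  have "(\<lambda>k. Sym (X k)) \<longlonglongrightarrow> Sym Xs"
    using linear_Sym X by (rule bounded_linear.tendsto [OF iffD1 [OF linear_conv_bounded_linear]])
  then have "(\<lambda>k. Y (k + 2)) \<longlonglongrightarrow> Xs"
    using LIMSEQ_ignore_initial_segment [of "\<lambda>k. Sym (X k)" _ 2]
    by (simp add: YX Sym_fixes_symmetric_tensors [OF symXs])
  then have "Y \<longlonglongrightarrow> Xs" by (rule LIMSEQ_offset)
  then show ?thesis unfolding assms(9) [symmetric] by (intro conjI refl X opt)
qed

end
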